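(* Let $p\ge5$ be a prime, $g\ge0$ and $0\le c\le (p-3)/2$. Then $$(-1)^c\,\delta_g^{(2c)}=\frac{4^{1-g}}{p}\sum_{j=1}^{(p-1)/2}\left(\sin\frac{\pi j(2c+1)}{p}\right)\left(\sin\frac{\pi j}{p}\right)\left(\cos\frac{\pi j}{p}\right)^{-2g}.$$
   Context: Let $d=(p-1)/2$. The lollipop tree $T_g^{(2c)}$ is the trivalent graph consisting of $g$ loops, the $i$-th loop attached to a stick edge, the sticks being attached successively to a spine ending in a free trunk edge colored $2c$. Its (small admissible) colorings are the families of integers $(a_1,\dots,a_g;\,l_1,\dots,l_g;\,k_0,\dots,k_g)$ (stick colors $2a_i$, loop colors $l_i$, spine colors $2k_i$) with $k_0=0$, $k_g=c$, such that for every $i=1,\dots,g$: $0\le a_i\le l_i\le d-1$, $|k_{i-1}-a_i|\le k_i\le k_{i-1}+a_i$, and $k_{i-1}+a_i+k_i\le 2d-1$ (with all $0\le k_i\le d-1$). (Here $k_1=a_1$: sticks 1 and 2 meet at the first vertex; edges colored $0$ may be erased.) A coloring is even or odd according as $c+\sum_{i=1}^g a_i$ is even or odd. Let $\mathfrak e_g^{(2c)}$ and $\mathfrak o_g^{(2c)}$ be the numbers of even and odd colorings respectively (they depend on $p$), and $\delta_g^{(2c)}=\mathfrak e_g^{(2c)}-\mathfrak o_g^{(2c)}$. *)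

theory Defs
  imports Complex_Main "HOL-Library.FuncSet" "HOL-Computational_Algebra.Primes"
begin

text \<open>
  A coloring of the lollipop tree is a triple \<open>(a, l, k)\<close>: the \<open>i\<close>-th stick has color
  \<open>2 * a i\<close>, the \<open>i\<close>-th loop has color \<open>l i\<close>, and the spine edges have colors \<open>2 * k i\<close>.
  The families are finite, so the functions are taken to be extensional (that is,
  \<open>undefined\<close> outside their index set); otherwise the set of colorings would be infinite
  and its cardinality meaningless.
\<close>

definition lollipop_colorings ::
    "nat \<Rightarrow> nat \<Rightarrow> nat \<Rightarrow> ((nat \<Rightarrow> int) \<times> (nat \<Rightarrow> int) \<times> (nat \<Rightarrow> int)) set" where
  "lollipop_colorings p g c =
    (let d = (int p - 1) div 2 in
     {(a, l, k).
        a \<in> extensional {1..g} \<and> l \<in> extensional {1..g} \<and> k \<in> extensional {0..g} \<and>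
        k 0 = 0 \<and> k g = int c \<and>
        (\<forall>i\<in>{0..g}. 0 \<le> k i \<and> k i \<le> d - 1) \<and>
        (\<forall>i\<in>{1..g}.
           0 \<le> a i \<and> a i \<le> l i \<and> l i \<le> d - 1 \<and>
           \<bar>k (i - 1) - a i\<bar> \<le> k i \<and> k i \<le> k (i - 1) + a i \<and>
           k (i - 1) + a i + k i \<le> 2 * d - 1)})"

definition even_colorings_count :: "nat \<Rightarrow> nat \<Rightarrow> nat \<Rightarrow> nat" where
  "even_colorings_count p g c =
     card {(a, l, k) \<in> lollipop_colorings p g c. even (int c + (\<Sum>i=1..g. a i))}"

definition odd_colorings_count :: "nat \<Rightarrow> nat \<Rightarrow> nat \<Rightarrow> nat" where
  "odd_colorings_count p g c =
     card {(a, l, k) \<in> lollipop_colorings p g c. odd (int c + (\<Sum>i=1..g. a i))}"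

definition lollipop_delta :: "nat \<Rightarrow> nat \<Rightarrow> nat \<Rightarrow> int" where
  "lollipop_delta p g c = int (even_colorings_count p g c) - int (odd_colorings_count p g c)"

end

theory Submission imports Defs begin

text \<open>
  Write \<open>p = 2 d + 1\<close> and \<open>\<theta>\<^sub>j = \<pi> j / p\<close>. Since the parity of a coloring is that of
  \<open>c + \<Sum>a\<^sub>i\<close>, the left-hand side is the number of colorings counted with the sign
  \<open>(-1)\<close> to the power \<open>\<Sum>a\<^sub>i\<close>. Cutting the spine just before the last stick turns this signed
  count into a transfer-matrix product: passing from \<open>g\<close> to \<open>g + 1\<close> loops applies the operator
  \<open>M = \<Sum>\<^sub>x (-1)\<^sup>x (d - x) N\<^sub>x\<close>, where \<open>N\<^sub>x\<close> is the \<open>0\<close>-\<open>1\<close> matrix recording which spine colors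
  \<open>2k\<close>, \<open>2c\<close> may meet a stick of color \<open>2x\<close>, and \<open>d - x\<close> is the number of colors
  \<open>x, \<dots>, d - 1\<close> available to the loop (\<open>signed_count_Suc\<close>).

  The matrices \<open>N\<^sub>x\<close> are the fusion matrices of the Verlinde algebra, and they are
  diagonalized simultaneously by the vectors \<open>k \<mapsto> sin ((2k+1) \<theta>\<^sub>j)\<close>, with eigenvalues
  \<open>sin ((2x+1) \<theta>\<^sub>j) / sin \<theta>\<^sub>j\<close> (\<open>fusion_sum\<close>). Two rounds of telescoping evaluate the resulting
  eigenvalue of \<open>M\<close> as \<open>1 / (4 cos\<^sup>2 \<theta>\<^sub>j)\<close> (\<open>alternating_weighted_sine_sum\<close>). For \<open>g = 0\<close> the
  signed count is the indicator of \<open>c = 0\<close>, whose expansion in the eigenvectors is the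
  orthogonality relation \<open>sine_orthogonality\<close>; applying \<open>M\<close> to this expansion \<open>g\<close> times
  multiplies the \<open>j\<close>-th summand by the \<open>g\<close>-th power of its eigenvalue.
\<close>

section \<open>Trigonometric sums\<close>

lemma sum_sin_odd_multiples:
  fixes \<theta> :: real
  assumes "m \<le> n"
  shows "2 * sin \<theta> * (\<Sum>k=m..<n. sin ((2 * real k + 1) * \<theta>))
    = cos (2 * real m * \<theta>) - cos (2 * real n * \<theta>)"
proof -
  have "2 * sin \<theta> * (\<Sum>k=m..<n. sin ((2 * real k + 1) * \<theta>))
      = (\<Sum>k=m..<n. 2 * sin \<theta> * sin ((2 * real k + 1) * \<theta>))"
    by (simp add: sum_distrib_left)
  also have "\<dots> = (\<Sum>k=m..<n. (- cos (2 * real (Suc k) * \<theta>)) - (- cos (2 * real k * \<theta>)))"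
  proof (rule sum.cong[OF refl])
    fix k
    have "2 * real k * \<theta> = (2 * real k + 1) * \<theta> - \<theta>"
         "2 * real (Suc k) * \<theta> = (2 * real k + 1) * \<theta> + \<theta>"
      by (simp_all add: algebra_simps)
    then show "2 * sin \<theta> * sin ((2 * real k + 1) * \<theta>)
        = (- cos (2 * real (Suc k) * \<theta>)) - (- cos (2 * real k * \<theta>))"
      by (simp only: cos_add cos_diff) simp
  qed
  also have "\<dots> = cos (2 * real m * \<theta>) - cos (2 * real n * \<theta>)"
    using sum_Suc_diff'[OF assms, of "\<lambda>k. - cos (2 * real k * \<theta>)"] by simp
  finally show ?thesis .
qed

lemma sum_cos_even_multiples:
  fixes \<phi> :: real
  shows "2 * sin \<phi> * (\<Sum>j=1..n. cos (2 * real j * \<phi>)) = sin ((2 * real n + 1) * \<phi>) - sin \<phi>"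
proof (induction n)
  case (Suc n)
  have "(2 * real n + 1) * \<phi> = 2 * real (Suc n) * \<phi> - \<phi>"
       "(2 * real (Suc n) + 1) * \<phi> = 2 * real (Suc n) * \<phi> + \<phi>"
    by (simp_all add: algebra_simps)
  then have "sin ((2 * real (Suc n) + 1) * \<phi>) - sin ((2 * real n + 1) * \<phi>)
      = 2 * sin \<phi> * cos (2 * real (Suc n) * \<phi>)"
    by (simp only: sin_add sin_diff) simp
  moreover have "2 * sin \<phi> * (\<Sum>j=1..Suc n. cos (2 * real j * \<phi>))
      = 2 * sin \<phi> * (\<Sum>j=1..n. cos (2 * real j * \<phi>)) + 2 * sin \<phi> * cos (2 * real (Suc n) * \<phi>)"
    by (simp add: distrib_left del: of_nat_Suc)
  ultimately show ?case
    using Suc by linarith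
qed simp

text \<open>
  Spine colors \<open>2k\<close> that can meet a stick of color \<open>2x\<close> and a spine edge of color \<open>2c\<close>: the
  triangle inequalities together with the bound \<open>k + x + c \<le> 2d - 1\<close>. The relation is symmetric
  in \<open>k\<close>, \<open>x\<close>, \<open>c\<close>.
\<close>

definition fusion_set :: "nat \<Rightarrow> nat \<Rightarrow> nat \<Rightarrow> nat set" where
  "fusion_set d x c = {k. k < d \<and> c \<le> k + x \<and> x \<le> k + c \<and> k \<le> x + c \<and> k + x + c < 2 * d}"

lemma fusion_set_eq_interval:
  "fusion_set d x c = {max (x - c) (c - x)..<min (x + c + 1) (2 * d - x - c)}"
  unfolding fusion_set_def by auto

lemma finite_fusion_set [simp]: "finite (fusion_set d x c)"
  by (simp add: fusion_set_eq_interval)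

text \<open>
  Without the truncation this is the Clebsch--Gordan rule for the characters of \<open>SU(2)\<close>. Summing
  over an interval of \<open>k\<close> leaves a difference of two cosines. Since \<open>2 (2 d + 1) \<theta>\<close> is a period
  of the cosine, the two candidates for the upper end of the interval, \<open>x + c\<close> and
  \<open>2 d - 1 - x - c\<close>, leave the same cosine, so the truncation does not change the sum.
\<close>

lemma fusion_sum:
  fixes \<theta> :: real
  assumes period: "sin ((2 * real d + 1) * \<theta>) = 0" and nz: "sin \<theta> \<noteq> 0"
    and x: "x < d" and c: "c < d"
  shows "(\<Sum>k\<in>fusion_set d x c. sin ((2 * real k + 1) * \<theta>))
    = sin ((2 * real x + 1) * \<theta>) * sin ((2 * real c + 1) * \<theta>) / sin \<theta>"
proof -
  define m n where "m = max (x - c) (c - x)" and "n = min (x + c + 1) (2 * d - x - c)"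
  have mn: "m \<le> n"
    using x c unfolding m_def n_def by auto
  have lower: "cos (2 * real m * \<theta>) = cos (2 * (real x - real c) * \<theta>)"
  proof (cases "c \<le> x")
    case True
    then show ?thesis by (simp add: m_def)
  next
    case False
    then have "2 * real m * \<theta> = - (2 * (real x - real c) * \<theta>)"
      by (simp add: m_def algebra_simps)
    then show ?thesis by (metis cos_minus)
  qed
  have cos1: "cos (2 * ((2 * real d + 1) * \<theta>)) = 1"
    using period by (simp add: cos_double_sin del: distrib_right_numeral)
  have sin1: "sin (2 * ((2 * real d + 1) * \<theta>)) = 0"
    unfolding sin_double using period by simp
  have upper: "cos (2 * real n * \<theta>) = cos (2 * (real x + real c + 1) * \<theta>)"
  proof (cases "x + c + 1 \<le> 2 * d - x - c")
    case True
    then have "n = x + c + 1" by (simp add: n_def)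
    then show ?thesis by (simp add: algebra_simps)
  next
    case False
    then have n: "n = 2 * d - x - c" by (simp add: n_def)
    have n_real: "real n = 2 * real d - real x - real c"
      using x c by (simp add: n)
    have "2 * real n * \<theta>
        = 2 * ((2 * real d + 1) * \<theta>) - 2 * (real x + real c + 1) * \<theta>"
      unfolding n_real by (simp add: algebra_simps)
    then show ?thesis by (simp only: cos_diff cos1 sin1)
  qed
  have "2 * sin \<theta> * (\<Sum>k\<in>fusion_set d x c. sin ((2 * real k + 1) * \<theta>))
      = cos (2 * (real x - real c) * \<theta>) - cos (2 * (real x + real c + 1) * \<theta>)"
    using sum_sin_odd_multiples[OF mn, of \<theta>]
    unfolding fusion_set_eq_interval m_def[symmetric] n_def[symmetric] lower upper .
  also have "\<dots> = 2 * (sin ((2 * real x + 1) * \<theta>) * sin ((2 * real c + 1) * \<theta>))"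
  proof -
    have "2 * (real x - real c) * \<theta> = (2 * real x + 1) * \<theta> - (2 * real c + 1) * \<theta>"
         "2 * (real x + real c + 1) * \<theta> = (2 * real x + 1) * \<theta> + (2 * real c + 1) * \<theta>"
      by (simp_all add: algebra_simps)
    then show ?thesis by (simp only: cos_add cos_diff)
  qed
  finally show ?thesis
    using nz by (simp add: eq_divide_eq mult_ac)
qed

lemma alternating_sine_sum:
  fixes \<theta> :: real
  shows "2 * cos \<theta> * (\<Sum>x<n. (-1) ^ x * sin ((2 * real x + 1) * \<theta>))
    = - ((-1) ^ n * sin (2 * real n * \<theta>))"
proof (induction n)
  case (Suc n)
  have "2 * real n * \<theta> = (2 * real n + 1) * \<theta> - \<theta>"
       "2 * real (Suc n) * \<theta> = (2 * real n + 1) * \<theta> + \<theta>"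
    by (simp_all add: algebra_simps)
  then have step: "sin (2 * real (Suc n) * \<theta>) + sin (2 * real n * \<theta>)
      = 2 * cos \<theta> * sin ((2 * real n + 1) * \<theta>)"
    by (simp only: sin_add sin_diff) simp
  have "2 * cos \<theta> * (\<Sum>x<Suc n. (-1) ^ x * sin ((2 * real x + 1) * \<theta>))
      = - ((-1) ^ n * sin (2 * real n * \<theta>)) + (-1) ^ n * (2 * cos \<theta> * sin ((2 * real n + 1) * \<theta>))"
    using Suc by (simp add: distrib_left mult_ac)
  also have "\<dots> = - ((-1) ^ Suc n * sin (2 * real (Suc n) * \<theta>))"
    unfolding step[symmetric] by (simp add: algebra_simps)
  finally show ?case .
qed simp

text \<open>
  The weight \<open>n - x\<close> makes the left-hand side a sum of the partial sums of
  \<open>alternating_sine_sum\<close>. After a factor \<open>2 cos \<theta>\<close> these are alternating sines of even multiples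
  of \<open>\<theta>\<close>, so a second factor \<open>2 cos \<theta>\<close> makes their sum telescope again. When \<open>(2 n + 1) \<theta>\<close> is
  a multiple of \<open>\<pi>\<close>, only \<open>sin \<theta>\<close> survives on the right.
\<close>

lemma alternating_weighted_sine_sum:
  fixes \<theta> :: real
  shows "4 * (cos \<theta>)\<^sup>2 * (\<Sum>x<n. (-1) ^ x * (real n - real x) * sin ((2 * real x + 1) * \<theta>))
    = sin \<theta> - (-1) ^ n * sin ((2 * real n + 1) * \<theta>)"
proof (induction n)
  case (Suc n)
  let ?t = "\<lambda>x. (-1) ^ x * sin ((2 * real x + 1) * \<theta>)"
  have "(\<Sum>x<Suc n. (-1) ^ x * (real (Suc n) - real x) * sin ((2 * real x + 1) * \<theta>))
      = (\<Sum>x<Suc n. (-1) ^ x * (real n - real x) * sin ((2 * real x + 1) * \<theta>) + ?t x)"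
    by (rule sum.cong) (auto simp: algebra_simps)
  also have "\<dots> = (\<Sum>x<n. (-1) ^ x * (real n - real x) * sin ((2 * real x + 1) * \<theta>))
      + (\<Sum>x<Suc n. ?t x)"
    by (simp add: sum.distrib)
  finally have "4 * (cos \<theta>)\<^sup>2 *
        (\<Sum>x<Suc n. (-1) ^ x * (real (Suc n) - real x) * sin ((2 * real x + 1) * \<theta>))
      = (sin \<theta> - (-1) ^ n * sin ((2 * real n + 1) * \<theta>))
        + 2 * cos \<theta> * (2 * cos \<theta> * (\<Sum>x<Suc n. ?t x))"
    using Suc by (simp only: distrib_left power2_eq_square mult_ac)
  also have "\<dots> = sin \<theta> - (-1) ^ n * sin ((2 * real n + 1) * \<theta>)
        + (-1) ^ n * (2 * cos \<theta> * sin (2 * real (Suc n) * \<theta>))"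
    unfolding alternating_sine_sum by (simp add: mult_ac)
  also have "2 * cos \<theta> * sin (2 * real (Suc n) * \<theta>)
      = sin ((2 * real (Suc n) + 1) * \<theta>) + sin ((2 * real n + 1) * \<theta>)"
  proof -
    have "(2 * real n + 1) * \<theta> = 2 * real (Suc n) * \<theta> - \<theta>"
         "(2 * real (Suc n) + 1) * \<theta> = 2 * real (Suc n) * \<theta> + \<theta>"
      by (simp_all add: algebra_simps)
    then show ?thesis by (simp only: sin_add sin_diff) simp
  qed
  finally show ?case
    by (simp add: algebra_simps)
qed simp

text \<open>
  All powers of a nontrivial \<open>(2 d + 1)\<close>-th root of unity sum to \<open>0\<close>; pairing conjugate powers
  turns this into \<open>1 + 2 \<Sum>cos = 0\<close>. The proof reads it off from the Dirichlet kernel identity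
  \<open>sum_cos_even_multiples\<close> at \<open>\<phi> = \<pi> m / (2 d + 1)\<close>.
\<close>

lemma sum_cos_root_of_unity:
  assumes "0 < m" and "m < 2 * d + 1"
  shows "(\<Sum>j=1..d. cos (2 * real j * (pi * real m / real (2 * d + 1)))) = - 1 / 2"
proof -
  define \<phi> where "\<phi> = pi * real m / real (2 * d + 1)"
  have "(2 * real d + 1) * \<phi> = real m * pi"
    unfolding \<phi>_def by (simp add: field_simps)
  then have 0: "sin ((2 * real d + 1) * \<phi>) = 0" by simp
  have "real m < real (2 * d + 1)"
    using assms(2) by (simp only: of_nat_less_iff)
  then have "pi * real m < pi * real (2 * d + 1)"
    using mult_less_cancel_left_pos[OF pi_gt_zero] by blast
  then have "\<phi> < pi"
    unfolding \<phi>_def by (simp add: divide_less_eq)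
  moreover have "0 < \<phi>"
    using assms(1) unfolding \<phi>_def by simp
  ultimately have "sin \<phi> > 0" by (intro sin_gt_zero)
  moreover have "sin \<phi> * (2 * (\<Sum>j=1..d. cos (2 * real j * \<phi>)) + 1) = 0"
    using sum_cos_even_multiples[of \<phi> d] unfolding 0 by (simp add: distrib_left mult_ac)
  ultimately have "2 * (\<Sum>j=1..d. cos (2 * real j * \<phi>)) + 1 = 0"
    by (metis less_irrefl mult_eq_0_iff)
  then show ?thesis
    unfolding \<phi>_def by simp
qed

lemma sine_orthogonality:
  assumes "c < d"
  shows "4 / real (2 * d + 1) *
    (\<Sum>j=1..d. sin ((2 * real c + 1) * (pi * real j / real (2 * d + 1)))
      * sin (pi * real j / real (2 * d + 1))) = (if c = 0 then 1 else 0)"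
proof -
  let ?p = "real (2 * d + 1)"
  let ?C = "\<lambda>m. \<Sum>j=1..d. cos (2 * real j * (pi * real m / ?p))"
  have "2 * (\<Sum>j=1..d. sin ((2 * real c + 1) * (pi * real j / ?p)) * sin (pi * real j / ?p))
      = (\<Sum>j=1..d. cos (2 * real j * (pi * real c / ?p))
          - cos (2 * real j * (pi * real (c + 1) / ?p)))"
    unfolding sum_distrib_left
  proof (rule sum.cong[OF refl])
    fix j
    let ?t = "pi * real j / ?p"
    have "2 * real j * (pi * real c / ?p) = (2 * real c + 1) * ?t - ?t"
         "2 * real j * (pi * real (c + 1) / ?p) = (2 * real c + 1) * ?t + ?t"
      by (simp_all add: divide_simps) (simp_all add: algebra_simps)
    then show "2 * (sin ((2 * real c + 1) * ?t) * sin ?t)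
        = cos (2 * real j * (pi * real c / ?p)) - cos (2 * real j * (pi * real (c + 1) / ?p))"
      by (simp only: cos_add cos_diff)
  qed
  also have "\<dots> = ?C c - ?C (c + 1)"
    by (rule sum_subtractf)
  also have "?C (c + 1) = - 1 / 2"
    using assms by (intro sum_cos_root_of_unity) auto
  also have "?C c = (if c = 0 then real d else - 1 / 2)"
    using assms sum_cos_root_of_unity[of c d] by auto
  finally have "(\<Sum>j=1..d. sin ((2 * real c + 1) * (pi * real j / ?p)) * sin (pi * real j / ?p))
      = (if c = 0 then ?p / 4 else 0)"
    by (auto simp: field_simps split: if_splits)
  then show ?thesis by (simp del: of_nat_add of_nat_mult)
qed

section \<open>The signed count of colorings and its recursion\<close>

lemma mem_lollipop_colorings:
  "(a, l, k) \<in> lollipop_colorings (Suc (2 * d)) g c \<longleftrightarrow>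
     a \<in> extensional {1..g} \<and> l \<in> extensional {1..g} \<and> k \<in> extensional {0..g} \<and>
     k 0 = 0 \<and> k g = int c \<and>
     (\<forall>i\<in>{0..g}. 0 \<le> k i \<and> k i < int d) \<and>
     (\<forall>i\<in>{1..g}. 0 \<le> a i \<and> a i \<le> l i \<and> l i < int d \<and>
        \<bar>k (i - 1) - a i\<bar> \<le> k i \<and> k i \<le> k (i - 1) + a i \<and>
        k (i - 1) + a i + k i < 2 * int d)"
  unfolding lollipop_colorings_def Let_def by auto

definition signed_count :: "nat \<Rightarrow> nat \<Rightarrow> nat \<Rightarrow> real" where
  "signed_count p g c =
     (\<Sum>(a, l, k)\<in>lollipop_colorings p g c. (-1) powi (\<Sum>i=1..g. a i))"

text \<open>
  The possible data of the last lollipop: the color \<open>2k\<close> of the spine edge entering it, the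
  color \<open>2x\<close> of its stick and the color \<open>y\<close> of its loop.
\<close>

definition last_lollipops :: "nat \<Rightarrow> nat \<Rightarrow> (nat \<times> nat \<times> nat) set" where
  "last_lollipops d c = {(k, x, y). x \<le> y \<and> y < d \<and> k \<in> fusion_set d x c}"

lemma last_lollipops_eq_Sigma:
  "last_lollipops d c
    = (\<lambda>(x, y, k). (k, x, y)) ` (SIGMA x:{..<d}. {x..<d} \<times> fusion_set d x c)"
  unfolding last_lollipops_def by (auto simp: image_iff)

lemma finite_last_lollipops [simp]: "finite (last_lollipops d c)"
  unfolding last_lollipops_eq_Sigma by auto

text \<open>
  A coloring with \<open>g + 1\<close> lollipops is the same as a choice of the last lollipop and a coloring
  of the remaining tree whose trunk carries the color of the spine edge that was cut.
\<close>

lemma bij_betw_attach_lollipop: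
  fixes c d g :: nat
  assumes c: "c < d"
  defines "attach \<equiv> \<lambda>((\<kappa>::nat, x::nat, y::nat), (a, l, k)).
     (a(Suc g := int x), l(Suc g := int y), k(Suc g := int c))"
  shows "bij_betw attach
     (SIGMA t:last_lollipops d c. lollipop_colorings (Suc (2 * d)) g (fst t))
     (lollipop_colorings (Suc (2 * d)) (Suc g) c)"
proof (rule bij_betwI[where g = "\<lambda>(a, l, k). ((nat (k g), nat (a (Suc g)), nat (l (Suc g))),
     (restrict a {1..g}, restrict l {1..g}, restrict k {0..g}))"], goal_cases)
  case 1
  show ?case
  proof (rule Pi_I, clarify, goal_cases)
    case (1 \<kappa> x y a l k)
    from 1 c show ?case
      unfolding attach_def last_lollipops_def fusion_set_def
      by (auto simp: mem_lollipop_colorings extensional_def le_Suc_eq)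
  qed
next
  case 2
  show ?case
  proof (rule Pi_I, clarify, goal_cases)
    case (1 a l k)
    then have step: "0 \<le> a (Suc g) \<and> a (Suc g) \<le> l (Suc g) \<and> l (Suc g) < int d \<and>
        \<bar>k g - a (Suc g)\<bar> \<le> k (Suc g) \<and> k (Suc g) \<le> k g + a (Suc g) \<and>
        k g + a (Suc g) + k (Suc g) < 2 * int d"
      unfolding mem_lollipop_colorings
      by (metis atLeastAtMost_iff diff_Suc_1 le_add1 le_refl plus_1_eq_Suc)
    have kg: "0 \<le> k g" "k g < int d" "k (Suc g) = int c"
      using 1 unfolding mem_lollipop_colorings by auto
    have "(nat (k g), nat (a (Suc g)), nat (l (Suc g))) \<in> last_lollipops d c"
      using step kg unfolding last_lollipops_def fusion_set_def by auto
    moreover have "(restrict a {1..g}, restrict l {1..g}, restrict k {0..g})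
        \<in> lollipop_colorings (Suc (2 * d)) g (nat (k g))"
      using 1 kg(1) unfolding mem_lollipop_colorings by auto
    ultimately show ?case by simp
  qed
next
  case (3 z)
  obtain \<kappa> x y a l k where z: "z = ((\<kappa>, x, y), (a, l, k))"
    by (metis prod.exhaust)
  from 3 have "k g = int \<kappa>" "a \<in> extensional {1..g}" "l \<in> extensional {1..g}"
      "k \<in> extensional {0..g}"
    unfolding z by (auto simp: mem_lollipop_colorings)
  then show ?case
    unfolding z attach_def by (auto simp: fun_eq_iff extensional_def restrict_def)
next
  case (4 z)
  obtain a l k where z: "z = (a, l, k)" by (metis prod.exhaust)
  have "0 \<le> a (Suc g) \<and> a (Suc g) \<le> l (Suc g)" "k (Suc g) = int c"
      "a \<in> extensional {1..Suc g}" "l \<in> extensional {1..Suc g}" "k \<in> extensional {0..Suc g}"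
    using 4 unfolding z mem_lollipop_colorings by auto
  then show ?case
    unfolding z attach_def
    by (auto simp: fun_eq_iff extensional_def restrict_def le_Suc_eq not_less_eq_eq)
qed

lemma lollipop_colorings_0:
  assumes "0 < d"
  shows "lollipop_colorings (Suc (2 * d)) 0 c =
    (if c = 0 then {(\<lambda>_. undefined, \<lambda>_. undefined, restrict (\<lambda>_. 0) {0})} else {})"
proof -
  have "(a, l, k) \<in> lollipop_colorings (Suc (2 * d)) 0 c \<longleftrightarrow>
      c = 0 \<and> a = (\<lambda>_. undefined) \<and> l = (\<lambda>_. undefined) \<and> k = restrict (\<lambda>_. 0) {0}" for a l k
    using assms
    by (auto simp: mem_lollipop_colorings extensional_def fun_eq_iff restrict_def)
  then show ?thesis by auto
qed

lemma finite_lollipop_colorings: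
  assumes "c < d"
  shows "finite (lollipop_colorings (Suc (2 * d)) g c)"
  using assms
proof (induction g arbitrary: c)
  case 0
  then show ?case by (simp add: lollipop_colorings_0 del: One_nat_def)
next
  case (Suc g)
  have "finite (SIGMA t:last_lollipops d c. lollipop_colorings (Suc (2 * d)) g (fst t))"
    by (rule finite_SigmaI[OF finite_last_lollipops Suc.IH])
       (auto simp: last_lollipops_def fusion_set_def)
  then show ?case
    using bij_betw_finite[OF bij_betw_attach_lollipop[OF Suc.prems]] by blast
qed

lemma signed_count_0:
  assumes "0 < d"
  shows "signed_count (Suc (2 * d)) 0 c = (if c = 0 then 1 else 0)"
  unfolding signed_count_def lollipop_colorings_0[OF assms] by simp

text \<open>
  The transfer-matrix recursion. The loop color enters neither the sign nor the conditions on the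
  rest of the tree, so summing over it only contributes the factor \<open>d - x\<close>.
\<close>

lemma signed_count_Suc:
  assumes c: "c < d"
  shows "signed_count (Suc (2 * d)) (Suc g) c =
    (\<Sum>x<d. (-1) ^ x * (real d - real x) *
       (\<Sum>k\<in>fusion_set d x c. signed_count (Suc (2 * d)) g k))"
proof -
  have "signed_count (Suc (2 * d)) (Suc g) c
      = (\<Sum>((\<kappa>, x, y), (a, l, k))\<in>
           (SIGMA t:last_lollipops d c. lollipop_colorings (Suc (2 * d)) g (fst t)).
         (-1) ^ x * (-1) powi (\<Sum>i=1..g. a i))"
    unfolding signed_count_def
  proof (subst sum.reindex_bij_betw[OF bij_betw_attach_lollipop[OF c], symmetric],
         rule sum.cong[OF refl], clarify, goal_cases)
    case (1 \<kappa> x y a l k)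
    have "(\<Sum>i=1..Suc g. (a(Suc g := int x)) i) = (\<Sum>i=1..g. a i) + int x"
      by simp
    then show ?case by (simp add: power_int_add)
  qed
  also have "\<dots> = (\<Sum>(\<kappa>, x, y)\<in>last_lollipops d c. (-1) ^ x * signed_count (Suc (2 * d)) g \<kappa>)"
  proof -
    have "\<forall>t\<in>last_lollipops d c. finite (lollipop_colorings (Suc (2 * d)) g (fst t))"
      by (intro ballI finite_lollipop_colorings) (auto simp: last_lollipops_def fusion_set_def)
    then show ?thesis
      unfolding signed_count_def
      by (subst sum.Sigma[symmetric])
         (auto simp: sum_distrib_left case_prod_unfold intro!: sum.cong)
  qed
  also have "\<dots> = (\<Sum>(x, y, \<kappa>)\<in>(SIGMA x:{..<d}. {x..<d} \<times> fusion_set d x c).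
      (-1) ^ x * signed_count (Suc (2 * d)) g \<kappa>)"
    unfolding last_lollipops_eq_Sigma
    by (subst sum.reindex) (auto simp: inj_on_def case_prod_unfold)
  also have "\<dots> = (\<Sum>x<d. \<Sum>y=x..<d. \<Sum>\<kappa>\<in>fusion_set d x c.
      (-1) ^ x * signed_count (Suc (2 * d)) g \<kappa>)"
    by (simp only: sum.cartesian_product) (simp add: sum.Sigma)
  also have "\<dots> = (\<Sum>x<d. (-1) ^ x * (real d - real x) *
       (\<Sum>k\<in>fusion_set d x c. signed_count (Suc (2 * d)) g k))"
    by (rule sum.cong[OF refl]) (simp add: of_nat_diff sum_distrib_left mult_ac)
  finally show ?thesis .
qed

section \<open>Diagonalization\<close>

text \<open>
  Eigenvectors of the transfer matrix in \<open>signed_count_Suc\<close>: \<open>fusion_sum\<close> diagonalizes the inner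
  sum over \<open>k\<close>, which leaves the sum over \<open>x\<close> evaluated in \<open>alternating_weighted_sine_sum\<close>.
\<close>

lemma transfer_eigenvector:
  fixes \<theta> :: real
  assumes period: "sin ((2 * real d + 1) * \<theta>) = 0" and "sin \<theta> \<noteq> 0" "cos \<theta> \<noteq> 0" and "c < d"
  shows "(\<Sum>x<d. (-1) ^ x * (real d - real x) *
       (\<Sum>k\<in>fusion_set d x c. sin ((2 * real k + 1) * \<theta>)))
    = sin ((2 * real c + 1) * \<theta>) / (4 * (cos \<theta>)\<^sup>2)"
proof -
  have "(\<Sum>x<d. (-1) ^ x * (real d - real x) *
       (\<Sum>k\<in>fusion_set d x c. sin ((2 * real k + 1) * \<theta>)))
      = (\<Sum>x<d. (-1) ^ x * (real d - real x) * sin ((2 * real x + 1) * \<theta>))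
        * (sin ((2 * real c + 1) * \<theta>) / sin \<theta>)"
    unfolding sum_distrib_right
    by (rule sum.cong[OF refl]) (simp add: fusion_sum[OF assms(1,2) _ assms(4)])
  also have "(\<Sum>x<d. (-1) ^ x * (real d - real x) * sin ((2 * real x + 1) * \<theta>))
      = sin \<theta> / (4 * (cos \<theta>)\<^sup>2)"
    using alternating_weighted_sine_sum[of \<theta> d] period assms(3) by (simp add: field_simps)
  finally show ?thesis using assms(2) by simp
qed

lemma signed_count_closed_form:
  assumes "c < d"
  shows "signed_count (Suc (2 * d)) g c = 4 / real (2 * d + 1) *
    (\<Sum>j=1..d. sin ((2 * real c + 1) * (pi * real j / real (2 * d + 1)))
      * sin (pi * real j / real (2 * d + 1)) / (4 * (cos (pi * real j / real (2 * d + 1)))\<^sup>2) ^ g)"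
  using assms
proof (induction g arbitrary: c)
  case 0
  then show ?case
    using sine_orthogonality[of c d] signed_count_0[of d c] by simp
next
  case (Suc g)
  define \<theta> where "\<theta> j = pi * real j / real (2 * d + 1)" for j
  \<comment> \<open>the coefficient of the \<open>j\<close>-th eigenvector in the expansion of the count for \<open>g\<close> loops\<close>
  define w where "w j = 4 / real (2 * d + 1) * sin (\<theta> j) / (4 * (cos (\<theta> j))\<^sup>2) ^ g" for j
  have eigen: "(\<Sum>x<d. (-1) ^ x * (real d - real x) *
       (\<Sum>k\<in>fusion_set d x c. sin ((2 * real k + 1) * \<theta> j)))
    = sin ((2 * real c + 1) * \<theta> j) / (4 * (cos (\<theta> j))\<^sup>2)" if j: "j \<in> {1..d}" for j
  proof (rule transfer_eigenvector)
    have "(2 * real d + 1) * \<theta> j = real j * pi"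
      unfolding \<theta>_def by (simp add: field_simps)
    then show "sin ((2 * real d + 1) * \<theta> j) = 0" by simp
    have "0 < \<theta> j" using j by (simp add: \<theta>_def)
    have "2 * real j < real (2 * d + 1)"
      using j by simp
    then have "pi * (2 * real j) < pi * real (2 * d + 1)"
      using mult_less_cancel_left_pos[OF pi_gt_zero] by blast
    then have "\<theta> j < pi / 2"
      unfolding \<theta>_def by (simp add: field_simps)
    with \<open>0 < \<theta> j\<close> show "sin (\<theta> j) \<noteq> 0" "cos (\<theta> j) \<noteq> 0"
      using sin_gt_zero[of "\<theta> j"] cos_gt_zero[of "\<theta> j"] by auto
  qed (fact Suc.prems)
  have IH: "signed_count (Suc (2 * d)) g k = (\<Sum>j=1..d. w j * sin ((2 * real k + 1) * \<theta> j))"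
    if "k \<in> fusion_set d x c" for k x
  proof -
    from that have "k < d" by (simp add: fusion_set_def)
    from Suc.IH[OF this] show ?thesis
      unfolding \<theta>_def w_def by (simp add: sum_distrib_left mult_ac)
  qed
  have "signed_count (Suc (2 * d)) (Suc g) c = (\<Sum>x<d. (-1) ^ x * (real d - real x) *
       (\<Sum>k\<in>fusion_set d x c. \<Sum>j=1..d. w j * sin ((2 * real k + 1) * \<theta> j)))"
    unfolding signed_count_Suc[OF Suc.prems]
    by (intro sum.cong refl arg_cong2[where f = "(*)"] IH)
  also have "\<dots> = (\<Sum>x<d. \<Sum>j=1..d. w j * ((-1) ^ x * (real d - real x) *
       (\<Sum>k\<in>fusion_set d x c. sin ((2 * real k + 1) * \<theta> j))))"
    by (subst sum.swap) (simp add: sum_distrib_left mult_ac)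
  also have "\<dots> = (\<Sum>j=1..d. w j * (\<Sum>x<d. (-1) ^ x * (real d - real x) *
       (\<Sum>k\<in>fusion_set d x c. sin ((2 * real k + 1) * \<theta> j))))"
    by (subst sum.swap) (simp add: sum_distrib_left)
  also have "\<dots> = (\<Sum>j=1..d. w j * (sin ((2 * real c + 1) * \<theta> j) / (4 * (cos (\<theta> j))\<^sup>2)))"
    by (intro sum.cong refl) (simp only: eigen)
  also have "\<dots> = 4 / real (2 * d + 1) * (\<Sum>j=1..d. sin ((2 * real c + 1) * \<theta> j)
      * sin (\<theta> j) / (4 * (cos (\<theta> j))\<^sup>2) ^ Suc g)"
    unfolding sum_distrib_left w_def by (intro sum.cong refl) (simp add: mult_ac)
  finally show ?case unfolding \<theta>_def .
qed

section \<open>Even minus odd colorings\<close>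

text \<open>
  The parity of a coloring includes the trunk color \<open>c\<close>; the factor \<open>(-1)\<^sup>c\<close> removes it again.
\<close>

lemma lollipop_delta_eq_signed_count:
  assumes "c < d"
  shows "(-1) ^ c * real_of_int (lollipop_delta (Suc (2 * d)) g c) = signed_count (Suc (2 * d)) g c"
proof -
  let ?L = "lollipop_colorings (Suc (2 * d)) g c"
  define E where "E = {(a, l, k) \<in> ?L. even (int c + (\<Sum>i=1..g. a i))}"
  define O' where "O' = {(a, l, k) \<in> ?L. odd (int c + (\<Sum>i=1..g. a i))}"
  let ?f = "\<lambda>(a, l :: nat \<Rightarrow> int, k :: nat \<Rightarrow> int). (-1 :: real) powi (\<Sum>i=1..g. a i)"
  have fin: "finite ?L" using assms by (rule finite_lollipop_colorings)
  have split: "?L = E \<union> O'" "E \<inter> O' = {}" by (auto simp: E_def O'_def)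
  have "finite E" "finite O'"
    using fin split(1) by simp_all
  then have "signed_count (Suc (2 * d)) g c = sum ?f E + sum ?f O'"
    unfolding signed_count_def split(1) using split(2) by (rule sum.union_disjoint)
  also have "sum ?f E = (\<Sum>_\<in>E. (-1) ^ c)"
    by (rule sum.cong[OF refl]) (auto simp: E_def power_int_minus_left uminus_power_if)
  also have "sum ?f O' = (\<Sum>_\<in>O'. - ((-1) ^ c))"
    by (rule sum.cong[OF refl]) (auto simp: O'_def power_int_minus_left uminus_power_if)
  finally show ?thesis
    unfolding lollipop_delta_def even_colorings_count_def odd_colorings_count_def
      E_def[symmetric] O'_def[symmetric]
    by (simp add: algebra_simps)
qed

theorem theorem2p7:
  fixes p g c :: nat
  assumes "prime p" and "p \<ge> 5" and "c \<le> (p - 3) div 2"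
  shows "(-1) ^ c * real_of_int (lollipop_delta p g c) =
    4 powi (1 - int g) / real p *
      (\<Sum>j = 1..(p - 1) div 2.
         sin (pi * real j * (2 * real c + 1) / real p) *
         sin (pi * real j / real p) *
         cos (pi * real j / real p) powi (- 2 * int g))"
proof -
  define d where "d = (p - 1) div 2"
  have "odd p"
    using assms(1,2) prime_odd_nat by force
  then have p: "p = Suc (2 * d)"
    unfolding d_def using assms(2) by (auto elim!: oddE)
  have c: "c < d"
    using assms(2,3) unfolding d_def by linarith
  have four: "4 powi (1 - int g) = 4 / (4::real) ^ g"
    by (simp add: power_int_diff)
  have cosine: "x powi (- 2 * int g) = 1 / (x\<^sup>2) ^ g" for x :: real
  proof -
    have "x powi (- 2 * int g) = inverse (x powi (int (2 * g)))"
      by (simp add: power_int_minus)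
    then show ?thesis
      by (simp only: power_int_of_nat power_mult inverse_eq_divide)
  qed
  have "(-1) ^ c * real_of_int (lollipop_delta p g c) = signed_count p g c"
    unfolding p by (rule lollipop_delta_eq_signed_count[OF c])
  also have "\<dots> = 4 / real p * (\<Sum>j=1..d. sin ((2 * real c + 1) * (pi * real j / real p))
      * sin (pi * real j / real p) / (4 * (cos (pi * real j / real p))\<^sup>2) ^ g)"
    unfolding p using signed_count_closed_form[OF c] by simp
  also have "\<dots> = 4 powi (1 - int g) / real p * (\<Sum>j=1..d.
         sin (pi * real j * (2 * real c + 1) / real p) *
         sin (pi * real j / real p) *
         cos (pi * real j / real p) powi (- 2 * int g))"
    unfolding sum_distrib_left four cosine
    by (rule sum.cong[OF refl]) (simp add: power_mult_distrib mult_ac)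
  finally show ?thesis
    unfolding d_def .
qed

end
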